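(* Let $G$ be a connected graph with $n$ vertices, minimum degree $\delta$, and diameter bigger than two. Then $$\pi^*(G)\le\frac{15\,n}{4(\delta+1)}.$$
   Context: All graphs are finite and simple. A pebbling distribution $D$ on a graph $G$ is a function $D:V(G)\to\mathbb{Z}_{\ge 0}$; its size is $|D|=\sum_v D(v)$. A pebbling move removes two pebbles from a vertex having at least two pebbles and places one pebble on an adjacent vertex. A vertex $v$ is reachable under $D$ if some sequence of legal pebbling moves puts at least one pebble on $v$. $D$ is solvable if every vertex is reachable. The optimal pebbling number $\pi^*(G)$ is the minimum size of a solvable distribution on $G$. *)

theory Defs
  imports "Graph_Theory.Graph_Theory"
begin

text \<open>
  Finite simple graphs are the locale \<^locale>\<open>graph\<close>: an undirected edge is a pair of
  opposite arcs, so the degree of a vertex is its out-degree. This holds because parallel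
  arcs and loops are excluded.
\<close>

definition min_degree :: "('a, 'b) pre_digraph \<Rightarrow> nat" where
  "min_degree G = Min (out_degree G ` verts G)"

text \<open>
  The distance is the library's shortest-path cost with unit arc weights, which is
  \<open>\<infinity>\<close> between vertices in different components.
\<close>

definition graph_dist :: "('a, 'b) pre_digraph \<Rightarrow> 'a \<Rightarrow> 'a \<Rightarrow> ereal" where
  "graph_dist G u v = wf_digraph.\<mu> G (\<lambda>_. 1) u v"

definition diameter :: "('a, 'b) pre_digraph \<Rightarrow> ereal" where
  "diameter G = (SUP u \<in> verts G. SUP v \<in> verts G. graph_dist G u v)"

text \<open>
  A pebbling distribution is a total function of which only the values on \<^term>\<open>verts G\<close>
  matter: the size sums over \<^term>\<open>verts G\<close>, and moves only involve endpoints of arcs.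
\<close>

type_synonym 'a distribution = "'a \<Rightarrow> nat"

definition dist_size :: "('a, 'b) pre_digraph \<Rightarrow> 'a distribution \<Rightarrow> nat" where
  "dist_size G D = (\<Sum>v \<in> verts G. D v)"

inductive pebbling_move :: "('a, 'b) pre_digraph \<Rightarrow> 'a distribution \<Rightarrow> 'a distribution \<Rightarrow> bool"
  for G where
  "u \<rightarrow>\<^bsub>G\<^esub> v \<Longrightarrow> 2 \<le> D u \<Longrightarrow> pebbling_move G D (D(u := D u - 2, v := D v + 1))"

definition pebble_reachable :: "('a, 'b) pre_digraph \<Rightarrow> 'a distribution \<Rightarrow> 'a \<Rightarrow> bool" where
  "pebble_reachable G D v \<longleftrightarrow> (\<exists>D'. (pebbling_move G)\<^sup>*\<^sup>* D D' \<and> 1 \<le> D' v)"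

definition solvable :: "('a, 'b) pre_digraph \<Rightarrow> 'a distribution \<Rightarrow> bool" where
  "solvable G D \<longleftrightarrow> (\<forall>v \<in> verts G. pebble_reachable G D v)"

definition optimal_pebbling_number :: "('a, 'b) pre_digraph \<Rightarrow> nat" where
  "optimal_pebbling_number G = (LEAST k. \<exists>D. solvable G D \<and> dist_size G D = k)"

lemma solvable_one: "solvable G (\<lambda>_. 1)"
  unfolding solvable_def pebble_reachable_def by auto

lemma optimal_pebbling_number_attained:
  "\<exists>D. solvable G D \<and> dist_size G D = optimal_pebbling_number G"
  unfolding optimal_pebbling_number_def by (rule LeastI_ex) (use solvable_one in blast)

lemma optimal_pebbling_number_le:
  "solvable G D \<Longrightarrow> optimal_pebbling_number G \<le> dist_size G D"
  unfolding optimal_pebbling_number_def by (rule Least_le) blast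

end

theory Submission
  imports Defs "HOL-Library.Function_Algebras"
begin

text \<open>
  Write \<open>K = \<delta> + 1\<close>, and call a vertex inner if its closed neighbourhood is reachable; no closed
  neighbourhood of an unreachable vertex contains an inner vertex. Extend the empty distribution
  greedily, always with the best ratio of new inner vertices to added pebbles, while this ratio is
  at least \<open>4K/15\<close>. When this gets stuck, testing a few extensions by at most 8 pebbles shows that
  every component \<open>C\<close> of the unreachable part has diameter at most two and that the closed
  neighbourhoods \<open>N[C]\<close> are pairwise disjoint, of size at least \<open>K\<close>.

  Each \<open>C\<close> can be reached with 4 more pebbles, which is slightly too expensive. But if the
  first \<open>J\<close> steps of the greedy process are doubled, then 3 pebbles suffice for each component
  whose boundary is reached within these steps. If step \<open>j\<close> is the first to reach the boundary
  of \<open>C\<close>, say in \<open>r\<close> next to \<open>x \<in> C\<close>, then it was at least as efficient as 4 pebbles on \<open>r\<close> and 2 on \<open>x\<close>, which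
  gain at least \<open>2K - g\<close> with \<open>g\<close> the number of common (closed) neighbours of \<open>r\<close> and \<open>x\<close>,
  whereas \<open>N[C]\<close> has at least \<open>K + g\<close> vertices. As the efficiencies decrease, a weighted average
  over \<open>J\<close> shows that some \<open>J\<close> gives a solution that is cheap enough.
\<close>

section \<open>Pebbles that can be collected at a vertex\<close>

definition pile :: "'a \<Rightarrow> nat \<Rightarrow> 'a distribution" where
  "pile u m = (\<lambda>x. if x = u then m else 0)"

lemma pile_same [simp]: "pile u m u = m"
  by (simp add: pile_def)

locale pebbling_graph = graph G for G :: "('a, 'b) pre_digraph"
begin

definition nb :: "'a \<Rightarrow> 'a set" where
  "nb x = insert x {y. x \<rightarrow>\<^bsub>G\<^esub> y}"

text \<open>An amount \<open>m\<close> instead of mere reachability, because amounts collected from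
  several distributions add up.\<close>

definition gets :: "'a distribution \<Rightarrow> 'a \<Rightarrow> nat \<Rightarrow> bool" where
  "gets D x m \<longleftrightarrow> (\<exists>D'. (pebbling_move G)\<^sup>*\<^sup>* D D' \<and> m \<le> D' x)"

definition reached :: "'a distribution \<Rightarrow> 'a set" where
  "reached D = {x \<in> verts G. gets D x 1}"

definition inner :: "'a distribution \<Rightarrow> 'a set" where
  "inner D = {x \<in> verts G. nb x \<subseteq> reached D}"

abbreviation pebbles :: "'a distribution \<Rightarrow> nat" where
  "pebbles D \<equiv> dist_size G D"

definition K :: nat where
  "K = min_degree G + 1"

lemma adj_neq: "x \<rightarrow>\<^bsub>G\<^esub> y \<Longrightarrow> x \<noteq> y"
  using adj_not_same by auto

lemma nb_refl [simp]: "x \<in> nb x"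
  by (simp add: nb_def)

lemma nb_sym: "y \<in> nb x \<longleftrightarrow> x \<in> nb y"
  using graph_symmetric by (auto simp: nb_def)

lemma nb_verts: "x \<in> verts G \<Longrightarrow> nb x \<subseteq> verts G"
  by (auto simp: nb_def dest: adj_in_verts)

lemma finite_nb: "x \<in> verts G \<Longrightarrow> finite (nb x)"
  using nb_verts finite_verts finite_subset by blast

lemma card_nb_ge: assumes "x \<in> verts G" shows "K \<le> card (nb x)"
proof -
  have "card (out_arcs G x) \<le> card {y. x \<rightarrow>\<^bsub>G\<^esub> y}"
  proof (rule card_inj_on_le)
    show "inj_on (head G) (out_arcs G x)"
      by (auto intro!: inj_onI no_multi_arcs simp: arc_to_ends_def)
    show "head G ` out_arcs G x \<subseteq> {y. x \<rightarrow>\<^bsub>G\<^esub> y}"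
      by (auto intro: in_arcs_imp_in_arcs_ends)
    show "finite {y. x \<rightarrow>\<^bsub>G\<^esub> y}"
      using finite_nb[OF assms] by (simp add: nb_def)
  qed
  moreover have "card (nb x) = Suc (card {y. x \<rightarrow>\<^bsub>G\<^esub> y})"
    using finite_nb[OF assms] adj_neq[of x x] unfolding nb_def
    by (subst card_insert_disjoint) auto
  moreover have "min_degree G \<le> out_degree G x"
    using assms by (simp add: min_degree_def)
  ultimately show ?thesis
    by (simp add: K_def out_degree_def)
qed

section \<open>Superposing distributions and moving along edges\<close>

lemma move_add: "pebbling_move G D D' \<Longrightarrow> pebbling_move G (D + E) (D' + E)"
proof (induction rule: pebbling_move.induct)
  case (1 u v D)
  have "D(u := D u - 2, v := D v + 1) + E = (D + E)(u := (D + E) u - 2, v := (D + E) v + 1)"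
    using 1 adj_neq[OF 1(1)] by (auto simp: fun_eq_iff)
  with 1 show ?case
    by (simp only:) (rule pebbling_move.intros, auto)
qed

lemma moves_add: "(pebbling_move G)\<^sup>*\<^sup>* D D' \<Longrightarrow> (pebbling_move G)\<^sup>*\<^sup>* (D + E) (D' + E)"
proof (induction rule: rtranclp_induct)
  case (step D' D'')
  then show ?case by (meson move_add rtranclp.rtrancl_into_rtrancl)
qed simp

text \<open>The two move sequences do not interfere: each runs while the other supply lies
  idle.\<close>

lemma gets_add: assumes "gets D x a" "gets E x b" shows "gets (D + E) x (a + b)"
proof -
  obtain D' where D': "(pebbling_move G)\<^sup>*\<^sup>* D D'" "a \<le> D' x"
    using assms(1) by (auto simp: gets_def)
  obtain E' where E': "(pebbling_move G)\<^sup>*\<^sup>* E E'" "b \<le> E' x"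
    using assms(2) by (auto simp: gets_def)
  have "(pebbling_move G)\<^sup>*\<^sup>* (D' + E) (D' + E')"
    using moves_add[OF E'(1), of D'] by (simp add: add.commute)
  with moves_add[OF D'(1), of E] have "(pebbling_move G)\<^sup>*\<^sup>* (D + E) (D' + E')"
    by simp
  with D' E' show ?thesis
    unfolding gets_def by (intro exI[of _ "D' + E'"]) auto
qed

lemma gets_self: "m \<le> D x \<Longrightarrow> gets D x m"
  by (auto simp: gets_def)

lemma gets_zero [simp]: "gets D x 0"
  by (auto simp: gets_def)

lemma gets_mono: "gets D x m \<Longrightarrow> m' \<le> m \<Longrightarrow> gets D x m'"
  unfolding gets_def using le_trans by blast

lemma gets_addI1: "gets D x m \<Longrightarrow> gets (D + E) x m"
  using gets_add[of D x m E 0] by simp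

lemma gets_addI2: "gets E x m \<Longrightarrow> gets (D + E) x m"
  using gets_add[of D x 0 E m] by simp

lemma moves_along_edge:
  assumes "x \<rightarrow>\<^bsub>G\<^esub> y"
  shows "2 * m \<le> D x \<Longrightarrow> \<exists>D'. (pebbling_move G)\<^sup>*\<^sup>* D D' \<and> D y + m \<le> D' y"
proof (induction m arbitrary: D)
  case 0
  then show ?case by auto
next
  case (Suc m)
  let ?D = "D(x := D x - 2, y := D y + 1)"
  have "2 * m \<le> ?D x"
    using Suc.prems adj_neq[OF assms] by auto
  with Suc.IH[of ?D] obtain D' where D': "(pebbling_move G)\<^sup>*\<^sup>* ?D D'" "?D y + m \<le> D' y"
    by blast
  have "pebbling_move G D ?D"
    using Suc.prems assms by (intro pebbling_move.intros) auto
  with D' show ?case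
    by (intro exI[of _ D']) auto
qed

lemma gets_nb:
  assumes "gets D x (2 * m)" "y \<in> nb x"
  shows "gets D y m"
proof (cases "y = x")
  case True
  with assms(1) show ?thesis by (auto intro: gets_mono)
next
  case False
  with assms(2) have "x \<rightarrow>\<^bsub>G\<^esub> y" by (simp add: nb_def)
  from assms(1) obtain D' where D': "(pebbling_move G)\<^sup>*\<^sup>* D D'" "2 * m \<le> D' x"
    by (auto simp: gets_def)
  from moves_along_edge[OF \<open>x \<rightarrow>\<^bsub>G\<^esub> y\<close>, of m D'] D'(2) obtain D'' where
    "(pebbling_move G)\<^sup>*\<^sup>* D' D''" "m \<le> D'' y"
    by force
  with D'(1) show ?thesis
    unfolding gets_def by (meson rtranclp_trans)
qed

lemma gets_nb_8: "gets D x 8 \<Longrightarrow> y \<in> nb x \<Longrightarrow> gets D y 4"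
  using gets_nb[of D x 4 y] by simp

lemma gets_nb_4: "gets D x 4 \<Longrightarrow> y \<in> nb x \<Longrightarrow> gets D y 2"
  using gets_nb[of D x 2 y] by simp

lemma gets_nb_2: "gets D x 2 \<Longrightarrow> y \<in> nb x \<Longrightarrow> gets D y 1"
  using gets_nb[of D x 1 y] by simp

section \<open>Sizes, reached and inner vertices\<close>

lemma pebbles_add [simp]: "pebbles (D + E) = pebbles D + pebbles E"
  by (simp add: dist_size_def sum.distrib)

lemma pebbles_pile [simp]: "u \<in> verts G \<Longrightarrow> pebbles (pile u m) = m"
  by (simp add: dist_size_def pile_def)

lemma pebbles_zero [simp]: "pebbles 0 = 0"
  by (simp add: dist_size_def)

lemma reached_add1: "reached D \<subseteq> reached (D + E)"
  by (auto simp: reached_def intro: gets_addI1)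

lemma inner_add: "inner D \<subseteq> inner (D + E)"
  using reached_add1 by (auto simp: inner_def)

lemma finite_inner: "finite (inner D)"
  by (auto simp: inner_def)

lemma card_inner_mono: "card (inner D) \<le> card (inner (D + E))"
  by (intro card_mono finite_inner inner_add)

lemma reached_verts: "reached D \<subseteq> verts G"
  by (auto simp: reached_def)

lemma inner_verts: "inner D \<subseteq> verts G"
  by (auto simp: inner_def)

lemma inner_subset_reached: "inner D \<subseteq> reached D"
  by (auto simp: inner_def)

lemma reached_zero: "reached 0 = {}"
proof -
  have "D' = 0" if "(pebbling_move G)\<^sup>*\<^sup>* 0 D'" for D'
    using that by (induction rule: rtranclp_induct) (auto elim: pebbling_move.cases)
  then show ?thesis
    by (force simp: reached_def gets_def)
qed

lemma inner_if_gets_2: "gets D x 2 \<Longrightarrow> x \<in> verts G \<Longrightarrow> x \<in> inner D"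
  using nb_verts gets_nb_2 by (auto simp: inner_def reached_def)

lemma nb_subset_inner: "gets F x 4 \<Longrightarrow> x \<in> verts G \<Longrightarrow> nb x \<subseteq> inner F"
  using nb_verts gets_nb_4 inner_if_gets_2 by blast

lemma reached_within_2: "gets F x 4 \<Longrightarrow> x \<in> verts G \<Longrightarrow> y \<in> nb x \<Longrightarrow> z \<in> nb y \<Longrightarrow> z \<in> reached F"
  using nb_verts gets_nb_4 gets_nb_2 unfolding reached_def by blast

text \<open>One pebble comes from each supply. This makes gains near reached vertices cheap: two
  pebbles on \<open>z\<close> already cover \<open>nb z\<close>.\<close>

lemma gets_2_if_reached: "z \<in> reached D \<Longrightarrow> gets F z 1 \<Longrightarrow> gets (D + F) z 2"
  using gets_add[of D z 1 F 1] by (simp add: reached_def numeral_2_eq_2)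

lemma inner_if_reached: "z \<in> reached D \<Longrightarrow> gets F z 1 \<Longrightarrow> z \<in> inner (D + F)"
  using gets_2_if_reached inner_if_gets_2 by (auto simp: reached_def)

lemma gets_pile: "gets (pile x m) x m"
  by (simp add: gets_self)

lemma gets_pile_4: "y \<in> nb x \<Longrightarrow> z \<in> nb y \<Longrightarrow> gets (pile x 4) z 1"
  using gets_nb_2 gets_nb_4 gets_pile by blast

lemma solvable_iff: "solvable G D \<longleftrightarrow> verts G \<subseteq> reached D"
  by (auto simp: solvable_def reached_def pebble_reachable_def gets_def)

text \<open>The reason to count inner instead of reached vertices: once \<open>nb u\<close> becomes
  inner, all of it is new gain.\<close>

lemma nb_inner_disjoint: "u \<notin> reached D \<Longrightarrow> nb u \<inter> inner D = {}"
  using nb_sym by (auto simp: inner_def)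

end

section \<open>Distributions without efficient extensions\<close>

locale stuck_distribution = pebbling_graph +
  fixes D :: "'a distribution"
  assumes stuck: "0 < pebbles E \<Longrightarrow> 15 * card (inner (D + E)) < 15 * card (inner D) + 4 * K * pebbles E"
begin

section \<open>The unreached part and its boundary\<close>

definition U :: "'a set" where
  "U = verts G - reached D"

text \<open>Reflexive on \<open>U\<close>, so that \<open>A O A\<close> means distance at most two
  inside the unreached part.\<close>

definition A :: "'a rel" where
  "A = {(x, y). x \<in> U \<and> y \<in> U \<and> y \<in> nb x}"

definition R :: "'a \<Rightarrow> 'a set" where
  "R x = nb x \<inter> reached D"

lemma U_verts: "x \<in> U \<Longrightarrow> x \<in> verts G"
  by (simp add: U_def)

lemma nb_U: "x \<in> U \<Longrightarrow> nb x \<inter> inner D = {}"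
  by (simp add: U_def nb_inner_disjoint)

lemma nb_cases: "x \<in> U \<Longrightarrow> y \<in> nb x \<Longrightarrow> y \<notin> reached D \<Longrightarrow> (x, y) \<in> A"
  using nb_verts by (auto simp: A_def U_def)

lemma A_U: "(x, y) \<in> A \<Longrightarrow> x \<in> U \<and> y \<in> U"
  by (simp add: A_def)

lemma A_nb: "(x, y) \<in> A \<Longrightarrow> y \<in> nb x"
  by (simp add: A_def)

lemma A_refl: "x \<in> U \<Longrightarrow> (x, x) \<in> A"
  by (simp add: A_def)

lemma A_sym: "(x, y) \<in> A \<Longrightarrow> (y, x) \<in> A"
  using nb_sym by (auto simp: A_def)

lemma gain:
  assumes "S \<subseteq> inner (D + E)" "S \<inter> inner D = {}" "0 < pebbles E"
  shows "15 * card S < 4 * K * pebbles E"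
proof -
  have "card S + card (inner D) = card (S \<union> inner D)"
    using assms finite_inner finite_subset by (subst card_Un_disjoint) blast+
  also have "\<dots> \<le> card (inner (D + E))"
    using assms(1) inner_add by (intro card_mono finite_inner) auto
  finally show ?thesis
    using stuck[OF assms(3)] by simp
qed

text \<open>Four pebbles on \<open>v\<close> make \<open>nb v\<close> inner and send one to each
  vertex of \<open>R w\<close>, which becomes inner too as it was reached before. Their gain is
  below \<open>16 * K / 15\<close>, and \<open>nb v\<close> takes \<open>K\<close> of it.\<close>

lemma R_diff:
  assumes "(v, w) \<in> A"
  shows "15 * card (R w - R v) < K"
proof -
  have v: "v \<in> U" "v \<in> verts G" and w: "w \<in> U" "w \<in> verts G" "w \<in> nb v"
    using assms by (auto dest: A_U A_nb U_verts)
  let ?E = "pile v 4"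
  have "R w - R v \<subseteq> inner (D + ?E)"
    using w gets_nb_4[OF gets_pile, of w v] gets_nb_2 inner_if_reached by (auto simp: R_def)
  moreover have "nb v \<subseteq> inner (D + ?E)"
    using v by (intro nb_subset_inner gets_addI2 gets_pile)
  moreover have "(nb v \<union> (R w - R v)) \<inter> inner D = {}"
    using nb_U v w by (auto simp: R_def)
  ultimately have "15 * card (nb v \<union> (R w - R v)) < 16 * K"
    using gain[of "nb v \<union> (R w - R v)" ?E] v by simp
  moreover have "card (nb v \<union> (R w - R v)) = card (nb v) + card (R w - R v)"
    using finite_nb[OF v(2)] finite_nb[OF w(2)] by (subst card_Un_disjoint) (auto simp: R_def)
  ultimately show ?thesis
    using card_nb_ge[OF v(2)] by simp
qed

lemma finite_R: "x \<in> verts G \<Longrightarrow> finite (R x)"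
  by (simp add: R_def finite_nb)

text \<open>Otherwise two pebbles on \<open>v\<close> give two pebbles to every vertex of \<open>R v\<close>, and by \<open>R_diff\<close> every
  unreached vertex at distance at most two from \<open>v\<close> has a neighbour in \<open>R v\<close>; hence all of \<open>nb v\<close>
  becomes inner.\<close>

lemma R_small:
  assumes v: "v \<in> U"
  shows "15 * card (R v) < 2 * K"
proof (rule ccontr)
  assume *: "\<not> 15 * card (R v) < 2 * K"
  let ?E = "pile v 2"
  have vV: "v \<in> verts G" using v by (rule U_verts)
  have R_v: "gets (D + ?E) z 2" if "z \<in> R v" for z
    using that gets_nb_2[OF gets_pile] gets_2_if_reached by (auto simp: R_def)
  have "nb x \<subseteq> reached (D + ?E)" if x: "(v, x) \<in> A" for x
  proof
    fix y assume y: "y \<in> nb x"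
    show "y \<in> reached (D + ?E)"
    proof (cases "y \<in> reached D")
      case True
      then show ?thesis using reached_add1 by auto
    next
      case False
      with x y have xy: "(x, y) \<in> A" by (auto dest: A_U intro: nb_cases)
      have fin: "finite (R v)" "finite (R x)" "finite (R y)"
        using x xy by (auto dest!: A_U U_verts intro: finite_R)
      have "R v \<inter> R y \<noteq> {}"
      proof
        assume "R v \<inter> R y = {}"
        then have "R v \<subseteq> (R v - R x) \<union> (R x - R y)" by auto
        then have "card (R v) \<le> card (R v - R x) + card (R x - R y)"
          using fin by (meson card_Un_le card_mono finite_Diff finite_Un le_trans)
        then show False
          using * R_diff[OF A_sym[OF x]] R_diff[OF A_sym[OF xy]] by simp
      qed
      then obtain z where "z \<in> R v" "z \<in> R y" by auto
      then show ?thesis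
        using R_v[of z] gets_nb_2 nb_sym xy by (auto simp: reached_def R_def dest: A_U U_verts)
    qed
  qed
  then have "nb v \<subseteq> inner (D + ?E)"
    using R_v nb_cases[OF v] inner_if_gets_2 nb_verts[OF vV] by (fastforce simp: inner_def R_def)
  then have "15 * card (nb v) < 8 * K"
    using gain[of "nb v" ?E] nb_U[OF v] vV by simp
  with card_nb_ge[OF vV] show False by simp
qed

text \<open>A common neighbour \<open>y\<close> would be reached, so that 3 pebbles on \<open>y\<close> and 2 on each of \<open>a\<close> and \<open>z\<close>
  collect to 4 on each of these three vertices.\<close>

lemma nb_disjoint:
  assumes a: "a \<in> U" and z: "z \<in> U" and az: "(a, z) \<notin> A O A"
  shows "nb a \<inter> nb z = {}"
proof (rule ccontr)
  assume "nb a \<inter> nb z \<noteq> {}"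
  then obtain y where y: "y \<in> nb a" "y \<in> nb z" by auto
  have V: "a \<in> verts G" "z \<in> verts G" using a z by (auto intro: U_verts)
  have sub: "nb a \<inter> nb z \<subseteq> R a"
    using nb_cases[OF a] nb_cases[OF z] A_sym az by (fastforce simp: R_def)
  with y have yR: "y \<in> reached D" by (auto simp: R_def)
  then have yV: "y \<in> verts G" using reached_verts by auto
  let ?E = "pile y 3 + pile a 2 + pile z 2"
  have y4: "gets (D + pile y 3) y 4"
    using gets_add[OF _ gets_pile[of y 3], of D 1] yR by (simp add: reached_def)
  have "gets (D + pile y 3 + pile a 2) a 4" "gets (D + pile y 3 + pile z 2) z 4"
    using gets_add[OF gets_nb_4[OF y4] gets_pile[of _ 2]] y nb_sym by auto
  then have "gets (D + ?E) a 4" "gets (D + ?E) z 4"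
    using gets_addI1[of "D + pile y 3 + pile a 2" a 4 "pile z 2"]
      gets_addI1[of "D + pile y 3 + pile z 2" z 4 "pile a 2"] by (simp_all add: ac_simps)
  then have "nb a \<union> nb z \<subseteq> inner (D + ?E)"
    using nb_subset_inner V by auto
  then have "15 * card (nb a \<union> nb z) < 28 * K"
    using gain[of "nb a \<union> nb z" ?E] nb_U a z V yV by auto
  moreover have "card (nb a) + card (nb z) = card (nb a \<union> nb z) + card (nb a \<inter> nb z)"
    using V finite_nb by (intro card_Un_Int) auto
  moreover have "card (nb a \<inter> nb z) \<le> card (R a)"
    using sub V finite_R by (intro card_mono) auto
  \<comment> \<open>By \<open>R_small\<close> the overlap is below \<open>2 * K / 15\<close>, so the
    union exceeds the \<open>28 * K / 15\<close> allowed for 7 pebbles.\<close>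
  ultimately show False
    using card_nb_ge V(1) card_nb_ge V(2) R_small[OF a] by fastforce
qed

text \<open>This is where the constant \<open>15/4\<close> comes from. Let \<open>o\<close> be the number of common neighbours of \<open>b\<close> and \<open>y\<close>,
  in units of \<open>K\<close>. The 7 pebbles 4 on \<open>b\<close>, 3 on \<open>y\<close> gain \<open>2 - o\<close>, and the 8 pebbles 4 on \<open>a\<close>,
  4 on \<open>z\<close> gain \<open>2 + o\<close>; so 15 pebbles gain 4.\<close>

lemma A3_closed:
  assumes ab: "(a, b) \<in> A" and bx: "(b, x) \<in> A" and xy: "(x, y) \<in> A" and yz: "(y, z) \<in> A"
  shows "(a, z) \<in> A O A O A"
proof (rule ccontr)
  assume *: "(a, z) \<notin> A O A O A"
  have U: "a \<in> U" "b \<in> U" "y \<in> U" "z \<in> U"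
    using assms by (auto dest: A_U)
  have V: "a \<in> verts G" "b \<in> verts G" "y \<in> verts G" "z \<in> verts G"
    using U U_verts by auto
  note fin = V[THEN finite_nb]
  have "nb a \<inter> nb y = {}" "nb b \<inter> nb z = {}" "nb a \<inter> nb z = {}"
  proof -
    have "(a, y) \<notin> A O A" "(b, z) \<notin> A O A" "(a, z) \<notin> A O A"
      using * ab yz A_refl U by auto
    then show "nb a \<inter> nb y = {}" "nb b \<inter> nb z = {}" "nb a \<inter> nb z = {}"
      using U by (auto simp: nb_disjoint)
  qed
  moreover have "15 * card (nb b \<union> nb y) < 28 * K"
  proof -
    let ?E = "pile b 4 + pile y 3"
    have "gets (pile b 4) y 1"
      using gets_pile_4 A_nb[OF bx] A_nb[OF xy] by blast
    then have "gets ?E y 4" using gets_add[OF _ gets_pile[of y 3]] by fastforce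
    moreover have "gets ?E b 4" by (intro gets_addI1 gets_pile)
    ultimately have "nb b \<union> nb y \<subseteq> inner (D + ?E)"
      using V gets_addI2 nb_subset_inner by blast
    then show ?thesis
      using gain[of "nb b \<union> nb y" ?E] nb_U U V by auto
  qed
  moreover have "15 * card (nb a \<union> nb z \<union> (nb b \<inter> nb y)) < 32 * K"
  proof -
    let ?E = "pile a 4 + pile z 4"
    \<comment> \<open>Such a \<open>w\<close> is within distance two of both \<open>a\<close> and
      \<open>z\<close>, so each pile sends one pebble.\<close>
    have "gets ?E w 2" if w: "w \<in> nb b \<inter> nb y" for w
    proof -
      have "gets (pile a 4) w 1" "gets (pile z 4) w 1"
        using w gets_pile_4 A_nb[OF ab] A_nb[OF A_sym[OF yz]] by blast+
      from gets_add[OF this] show ?thesis by (simp add: numeral_2_eq_2)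
    qed
    then have "nb b \<inter> nb y \<subseteq> inner (D + ?E)"
      using gets_addI2 inner_if_gets_2 nb_verts V(2) by blast
    moreover have "gets ?E a 4" "gets ?E z 4"
      by (auto intro: gets_addI1 gets_addI2 gets_pile)
    then have "nb a \<union> nb z \<subseteq> inner (D + ?E)"
      using V gets_addI2 nb_subset_inner by blast
    moreover have "(nb a \<union> nb z \<union> (nb b \<inter> nb y)) \<inter> inner D = {}"
      using nb_U U by blast
    ultimately show ?thesis
      using gain[of "nb a \<union> nb z \<union> (nb b \<inter> nb y)" ?E] V by auto
  qed
  moreover have "card (nb a \<union> nb z \<union> (nb b \<inter> nb y)) = card (nb a) + card (nb z) + card (nb b \<inter> nb y)"
    if "nb a \<inter> nb y = {}" "nb b \<inter> nb z = {}" "nb a \<inter> nb z = {}"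
  proof -
    have "card (nb a \<union> nb z \<union> (nb b \<inter> nb y)) = card (nb a \<union> nb z) + card (nb b \<inter> nb y)"
      using that fin by (intro card_Un_disjoint) auto
    with that fin show ?thesis by (simp add: card_Un_disjoint)
  qed
  moreover have "card (nb b) + card (nb y) = card (nb b \<union> nb y) + card (nb b \<inter> nb y)"
    using fin by (intro card_Un_Int) auto
  ultimately show False
    using V[THEN card_nb_ge] by simp
qed

text \<open>Hence three steps from \<open>u\<close> already exhaust the component of
  \<open>u\<close>.\<close>

lemma A3_step: "(u, y) \<in> A O A O A \<Longrightarrow> (y, z) \<in> A \<Longrightarrow> (u, z) \<in> A O A O A"
  by (auto intro: A3_closed)

text \<open>A neighbour of \<open>C\<close> outside \<open>C\<close> is reached under
  \<open>D\<close> already.\<close>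

lemma closed_subset_inner:
  assumes "C \<subseteq> U" "\<And>x y. x \<in> C \<Longrightarrow> (x, y) \<in> A \<Longrightarrow> y \<in> C" "C \<subseteq> reached (D + E)"
  shows "C \<subseteq> inner (D + E)"
proof -
  have "nb x \<subseteq> reached (D + E)" if x: "x \<in> C" for x
  proof
    fix y assume y: "y \<in> nb x"
    show "y \<in> reached (D + E)"
    proof (cases "y \<in> reached D")
      case True
      then show ?thesis using reached_add1 by auto
    next
      case False
      with x y assms(1) nb_cases have "(x, y) \<in> A" by auto
      with x assms(2,3) show ?thesis by auto
    qed
  qed
  with assms(1) U_verts show ?thesis by (auto simp: inner_def)
qed

text \<open>By \<open>A3_closed\<close>, 8 pebbles on \<open>u\<close> reach the whole component \<open>C\<close> of \<open>u\<close>, so \<open>C\<close> is small. If 4 pebbles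
  on \<open>u\<close> and 3 on \<open>w\<close> miss a vertex \<open>s\<close>, then \<open>nb s\<close> leaves little room for \<open>nb u \<union> nb w\<close>, so \<open>w\<close> has almost
  the same neighbours as \<open>u\<close>; similarly 6 pebbles on the edge \<open>wq\<close> show that \<open>q\<close> shares many
  neighbours with \<open>w\<close>, hence one with \<open>u\<close>.\<close>

lemma A3_subset_A2:
  assumes ua: "(u, a) \<in> A" and aw: "(a, w) \<in> A" and wq: "(w, q) \<in> A"
  shows "(u, q) \<in> A O A"
proof (rule ccontr)
  assume *: "(u, q) \<notin> A O A"
  define C where "C = (A O A O A) `` {u}"
  have U: "u \<in> U" "a \<in> U" "w \<in> U" "q \<in> U"
    using assms by (auto dest: A_U)
  have V: "u \<in> verts G" "a \<in> verts G" "w \<in> verts G" "q \<in> verts G"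
    using U U_verts by auto
  note fin = V[THEN finite_nb]
  have C_U: "C \<subseteq> U" by (auto simp: C_def dest: A_U)
  have C_closed: "x \<in> C \<Longrightarrow> (x, y) \<in> A \<Longrightarrow> y \<in> C" for x y
    unfolding C_def using A3_step by auto
  have uq: "nb u \<inter> nb q = {}" using * U by (intro nb_disjoint)
  have uC: "u \<in> C" using U A_refl by (auto simp: C_def)
  have aC: "a \<in> C" and wC: "w \<in> C" and qC: "q \<in> C"
    using uC ua aw wq C_closed by blast+
  have nb_C: "nb x \<subseteq> C \<union> R x" if "x \<in> C" for x
  proof
    fix y assume y: "y \<in> nb x"
    show "y \<in> C \<union> R x"
      using that y C_U C_closed[OF that] nb_cases[of x y] by (cases "y \<in> reached D") (auto simp: R_def)
  qed
  \<comment> \<open>Otherwise these 7 pebbles would make the disjoint sets \<open>nb u\<close> and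
    \<open>nb q\<close> inner, a gain of at least \<open>2 * K > 28 * K / 15\<close>.\<close>
  obtain s where s: "s \<in> C" "s \<notin> reached (D + (pile u 4 + pile w 3))"
  proof (rule ccontr)
    assume "\<not> thesis"
    let ?E = "pile u 4 + pile w 3"
    have C_inner: "C \<subseteq> inner (D + ?E)"
      using \<open>\<not> thesis\<close> that C_closed C_U by (intro closed_subset_inner) auto
    have "gets (pile u 4) w 1"
      using gets_pile_4 A_nb[OF ua] A_nb[OF aw] by blast
    then have w4: "gets ?E w 4" using gets_add[OF _ gets_pile[of w 3]] by fastforce
    have u4: "gets ?E u 4" by (intro gets_addI1 gets_pile)
    have "R q \<subseteq> inner (D + ?E)"
      using gets_nb_2[OF gets_nb_4[OF w4 A_nb[OF wq]]] inner_if_reached by (auto simp: R_def)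
    with C_inner nb_C[OF qC] have "nb q \<subseteq> inner (D + ?E)" by auto
    moreover have "nb u \<subseteq> inner (D + ?E)"
      using V u4 gets_addI2 nb_subset_inner by blast
    ultimately have "15 * card (nb u \<union> nb q) < 28 * K"
      using gain[of "nb u \<union> nb q" ?E] nb_U U V by auto
    moreover have "card (nb u \<union> nb q) = card (nb u) + card (nb q)"
      using fin uq by (simp add: card_Un_disjoint)
    ultimately show False using V[THEN card_nb_ge] by simp
  qed
  have sU: "s \<in> U" using s C_U by auto
  then have sV: "s \<in> verts G" by (rule U_verts)
  have far: "nb s \<inter> nb u = {}" "nb s \<inter> nb w = {}"
  proof -
    let ?E = "pile u 4 + pile w 3"
    have "gets (pile u 4) w 1"
      using gets_pile_4 A_nb[OF ua] A_nb[OF aw] by blast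
    then have w4: "gets (D + ?E) w 4" using gets_add[OF _ gets_pile[of w 3]] gets_addI2 by fastforce
    have u4: "gets (D + ?E) u 4" by (intro gets_addI1 gets_addI2 gets_pile)
    show "nb s \<inter> nb u = {}" "nb s \<inter> nb w = {}"
      using reached_within_2[OF w4 V(3)] reached_within_2[OF u4 V(1)] s(2) nb_sym by blast+
  qed
  obtain x where x: "(u, x) \<in> A O A" "(x, s) \<in> A"
    using s(1) by (auto simp: C_def)
  \<comment> \<open>From 8 pebbles on \<open>u\<close>, two arrive at \<open>x\<close> and so one at
    each vertex of \<open>R x\<close>. The rest of \<open>R s\<close> may get none and is left out;
    by \<open>R_diff\<close> it is smaller than \<open>K / 15\<close>.\<close>
  define S where "S = nb u \<union> nb w \<union> (nb s - (R s - R x))"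
  have "15 * card S < 32 * K"
  proof -
    let ?E = "pile u 8"
    have g4: "gets ?E y 4" if "(u, y) \<in> A" for y
      using that gets_nb_8[OF gets_pile] A_nb by blast
    have g2: "gets ?E y 2" if "(u, y) \<in> A O A" for y
      using that g4 gets_nb_4 A_nb by blast
    have g1: "gets ?E y 1" if "(u, y) \<in> A O A O A" for y
      using that g2 gets_nb_2 A_nb by blast
    have "C \<subseteq> reached (D + ?E)"
      using g1 gets_addI2 C_U U_verts unfolding C_def reached_def by blast
    then have "C \<subseteq> inner (D + ?E)"
      using C_U C_closed by (intro closed_subset_inner) auto
    moreover have RI: "R y \<subseteq> inner (D + ?E)" if "(u, y) \<in> A O A" for y
      using gets_nb_2[OF g2[OF that]] inner_if_reached by (auto simp: R_def)
    moreover have "S \<subseteq> C \<union> R u \<union> R w \<union> R x"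
      using nb_C[OF uC] nb_C[OF wC] nb_C[OF s(1)] by (auto simp: S_def)
    moreover have "(u, u) \<in> A O A" "(u, w) \<in> A O A"
      using ua aw U A_refl by auto
    ultimately have "S \<subseteq> inner (D + ?E)" using x(1) by blast
    moreover have "S \<inter> inner D = {}"
      using nb_U U sU by (auto simp: S_def)
    ultimately show ?thesis
      using gain[of S ?E] V by simp
  qed
  moreover have "card S = card (nb u \<union> nb w) + card (nb s - (R s - R x))"
    unfolding S_def using far fin finite_nb[OF sV] by (intro card_Un_disjoint) auto
  moreover have "card (nb s - (R s - R x)) = card (nb s) - card (R s - R x)"
    using finite_R[OF sV] by (intro card_Diff_subset) (auto simp: R_def)
  \<comment> \<open>Of \<open>32 * K / 15\<close>, the part of \<open>nb s\<close> in
    \<open>S\<close> uses more than \<open>14 * K / 15\<close>.\<close>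
  ultimately have "15 * card (nb u \<union> nb w) < 18 * K"
    using R_diff[OF x(2)] card_nb_ge[OF sV] by simp
  moreover have "card (nb u \<union> nb w) = card (nb u) + card (nb w - nb u)"
    using fin by (metis Diff_disjoint Un_Diff_cancel card_Un_disjoint finite_Diff)
  moreover have "15 * card (nb w \<union> nb q) < 24 * K"
  proof -
    let ?E = "pile w 4 + pile q 2"
    have "gets ?E q 4"
      using gets_add[OF gets_nb_4[OF gets_pile A_nb[OF wq]] gets_pile[of q 2]] by simp
    moreover have "gets ?E w 4" by (intro gets_addI1 gets_pile)
    ultimately have "nb w \<union> nb q \<subseteq> inner (D + ?E)"
      using V gets_addI2 nb_subset_inner by blast
    then show ?thesis
      using gain[of "nb w \<union> nb q" ?E] nb_U U V by auto
  qed
  moreover have "card (nb w) + card (nb q) = card (nb w \<union> nb q) + card (nb w \<inter> nb q)"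
    using fin by (intro card_Un_Int) auto
  \<comment> \<open>The left side exceeds \<open>6 * K / 15\<close> by the previous two facts, the
    right side is below \<open>3 * K / 15\<close>.\<close>
  moreover have "card (nb w \<inter> nb q) \<le> card (nb w - nb u)"
    using uq fin by (intro card_mono) auto
  ultimately show False
    using V[THEN card_nb_ge] by simp
qed

text \<open>Applying \<open>A3_subset_A2\<close> twice shortens four steps to two. So the classes of
  \<open>A O A\<close> are the connected components of the unreached part.\<close>

lemma near_trans:
  assumes "(x, y) \<in> A O A" "(y, z) \<in> A O A"
  shows "(x, z) \<in> A O A"
proof -
  obtain a b where "(x, a) \<in> A" "(a, y) \<in> A" "(y, b) \<in> A" "(b, z) \<in> A"
    using assms by auto
  moreover from this(1-3) obtain c where "(x, c) \<in> A" "(c, b) \<in> A"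
    using A3_subset_A2 by blast
  ultimately show ?thesis using A3_subset_A2 by blast
qed

section \<open>Components of the unreached part\<close>

lemma equiv_near: "equiv U (A O A)"
proof (rule equivI)
  show "refl_on U (A O A)" using A_refl by (auto simp: refl_on_def)
  show "sym (A O A)" by (intro symI) (use A_sym in blast)
  show "trans (A O A)" by (intro transI) (rule near_trans)
  show "A O A \<subseteq> U \<times> U" using A_U by auto
qed

definition comps :: "'a set set" where
  "comps = U // (A O A)"

lemma finite_comps: "finite comps"
proof -
  have "finite U" by (simp add: U_def)
  then show ?thesis
    using equiv_near unfolding comps_def by (auto intro: finite_quotient dest: equiv_type)
qed

lemma comps_U: "C \<in> comps \<Longrightarrow> C \<subseteq> U"
  unfolding comps_def using in_quotient_imp_subset[OF equiv_near] by blast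

lemma finite_comp: "C \<in> comps \<Longrightarrow> finite C"
  using comps_U finite_subset[of C U] by (simp add: U_def)

lemma comps_nonempty: "C \<in> comps \<Longrightarrow> C \<noteq> {}"
  unfolding comps_def using in_quotient_imp_non_empty[OF equiv_near] by blast

lemma comps_near: "C \<in> comps \<Longrightarrow> x \<in> C \<Longrightarrow> y \<in> C \<longleftrightarrow> (x, y) \<in> A O A"
  unfolding comps_def
  using in_quotient_imp_in_rel[OF equiv_near, of C x y]
    in_quotient_imp_closed[OF equiv_near, of C x y] by blast

lemma comps_closed: "C \<in> comps \<Longrightarrow> x \<in> C \<Longrightarrow> (x, y) \<in> A \<Longrightarrow> y \<in> C"
  using comps_near A_refl A_U by blast

lemma finite_nbs: "C \<in> comps \<Longrightarrow> finite (\<Union>(nb ` C))"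
  using comps_U U_verts nb_verts
  by (intro finite_subset[OF _ finite_verts]) blast

lemma comps_nb_disjoint:
  assumes "C \<in> comps" "C' \<in> comps" "C \<noteq> C'"
  shows "\<Union>(nb ` C) \<inter> \<Union>(nb ` C') = {}"
proof -
  have "nb x \<inter> nb y = {}" if "x \<in> C" "y \<in> C'" for x y
  proof (rule nb_disjoint)
    show "x \<in> U" "y \<in> U" using that assms comps_U by auto
    show "(x, y) \<notin> A O A"
      using that assms comps_near quotient_disj[OF equiv_near, of C C'] unfolding comps_def by blast
  qed
  then show ?thesis by blast
qed

lemma card_comps_le: "card (inner D) + (\<Sum>C\<in>comps. card (\<Union>(nb ` C))) \<le> card (verts G)"
proof -
  have "(\<Sum>C\<in>comps. card (\<Union>(nb ` C))) = card (\<Union>C\<in>comps. \<Union>(nb ` C))"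
    using finite_nbs comps_nb_disjoint finite_comps by (intro card_UN_disjoint[symmetric]) auto
  moreover have "inner D \<inter> (\<Union>C\<in>comps. \<Union>(nb ` C)) = {}"
    using nb_U comps_U by blast
  then have "card (inner D) + card (\<Union>C\<in>comps. \<Union>(nb ` C)) = card (inner D \<union> (\<Union>C\<in>comps. \<Union>(nb ` C)))"
    using finite_inner finite_comps finite_nbs by (intro card_Un_disjoint[symmetric]) auto
  moreover have "\<dots> \<le> card (verts G)"
    using comps_U U_verts nb_verts inner_verts by (intro card_mono finite_verts) blast
  ultimately show ?thesis by simp
qed

text \<open>Three pebbles on \<open>r\<close> cannot reach all of \<open>C\<close>, and a missed vertex \<open>z\<close> has \<open>nb z \<inter> nb r = {}\<close>.\<close>

lemma card_nbs_ge:
  assumes C: "C \<in> comps" and x: "x \<in> C" and r: "r \<in> R x"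
  shows "K + card (nb r \<inter> nb x) \<le> card (\<Union>(nb ` C))"
proof -
  let ?E = "pile r 3"
  have xU: "x \<in> U" and xV: "x \<in> verts G" using C x comps_U U_verts by auto
  have rV: "r \<in> verts G" and r4: "gets (D + ?E) r 4" and xr: "x \<in> nb r"
    using r reached_verts gets_add[OF _ gets_pile[of r 3], of D 1] nb_sym
    by (auto simp: R_def reached_def)
  have "\<not> C \<subseteq> reached (D + ?E)"
  proof
    assume "C \<subseteq> reached (D + ?E)"
    then have "C \<subseteq> inner (D + ?E)"
      using C comps_U comps_closed by (intro closed_subset_inner) auto
    moreover have "C \<inter> inner D = {}"
      using comps_U[OF C] inner_subset_reached by (auto simp: U_def)
    ultimately have "15 * card C < 12 * K"
      using gain[of C ?E] rV by simp
    moreover have "nb x - R x \<subseteq> C"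
      using comps_closed[OF C x] nb_cases[OF xU] by (auto simp: R_def)
    then have "card (nb x - R x) \<le> card C"
      by (intro card_mono finite_comp[OF C])
    moreover have "card (nb x - R x) = card (nb x) - card (R x)"
      using finite_R[OF xV] by (intro card_Diff_subset) (auto simp: R_def)
    \<comment> \<open>By \<open>R_small\<close>, \<open>nb x - R x\<close> has more than
      \<open>13 * K / 15\<close> elements.\<close>
    ultimately show False
      using R_small[OF xU] card_nb_ge[OF xV] by linarith
  qed
  then obtain z where z: "z \<in> C" "z \<notin> reached (D + ?E)" by auto
  have zV: "z \<in> verts G" using z C comps_U U_verts by auto
  have "nb z \<inter> nb r = {}"
    using reached_within_2[OF r4 rV] z nb_sym by blast
  then have "card (nb z) + card (nb r \<inter> nb x) = card (nb z \<union> (nb r \<inter> nb x))"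
    using finite_nb zV rV by (intro card_Un_disjoint[symmetric]) auto
  also have "\<dots> \<le> card (\<Union>(nb ` C))"
    using z x finite_nbs[OF C] by (intro card_mono) auto
  finally show ?thesis using card_nb_ge[OF zV] by simp
qed

text \<open>Without reached neighbours \<open>C\<close> would be the whole graph by connectedness.
  Then any two vertices would be at distance at most two, against \<open>far\<close>.\<close>

lemma comps_boundary:
  assumes conn: "\<And>u v. u \<in> verts G \<Longrightarrow> v \<in> verts G \<Longrightarrow> u \<rightarrow>\<^sup>*\<^bsub>G\<^esub> v"
    and far: "\<exists>u\<in>verts G. \<exists>v\<in>verts G. nb u \<inter> nb v = {}"
    and C: "C \<in> comps"
  shows "\<exists>x\<in>C. R x \<noteq> {}"
proof (rule ccontr)
  assume *: "\<not> (\<exists>x\<in>C. R x \<noteq> {})"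
  obtain x where x: "x \<in> C" using comps_nonempty[OF C] by auto
  have "y \<in> C" if "x \<rightarrow>\<^sup>*\<^bsub>G\<^esub> y" for y
    using that
  proof (induction rule: reachable_induct)
    case base
    then show ?case using x by simp
  next
    case (step y z)
    then have "z \<in> nb y" by (simp add: nb_def)
    with step * have "(y, z) \<in> A"
      using comps_U[OF C] nb_cases[of y z] by (auto simp: R_def)
    with step show ?case using comps_closed[OF C] by auto
  qed
  then have C_all: "verts G \<subseteq> C"
    using conn x comps_U[OF C] U_verts by blast
  obtain u v where uv: "u \<in> verts G" "v \<in> verts G" "nb u \<inter> nb v = {}"
    using far by auto
  with C_all have "(u, v) \<in> A O A" using comps_near[OF C, of u v] by auto
  then show False using uv A_nb A_sym by blast
qed

lemma solvable_if:
  assumes "reached D \<subseteq> reached F" "\<And>C. C \<in> comps \<Longrightarrow> \<exists>x\<in>C. gets F x 4"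
  shows "solvable G F"
proof -
  have "y \<in> reached F" if y: "y \<in> U" for y
  proof -
    obtain C where C: "C \<in> comps" "y \<in> C"
      using y unfolding comps_def by (meson A_refl quotientI relcomp.relcompI ImageI singletonI)
    then obtain x where x: "x \<in> C" "gets F x 4" using assms(2) by auto
    with C have "(x, y) \<in> A O A" using comps_near by auto
    then show ?thesis
      using reached_within_2[OF x(2)] A_nb A_U U_verts by blast
  qed
  then show ?thesis using assms(1) by (auto simp: solvable_iff U_def)
qed

end

section \<open>Greedy extension\<close>

context pebbling_graph
begin

definition growth :: "'a distribution \<Rightarrow> 'a distribution \<Rightarrow> nat" where
  "growth D E = card (inner (D + E)) - card (inner D)"

text \<open>Ratios of growth to pebbles, compared by cross-multiplication; the threshold is the one
  at which a distribution counts as stuck.\<close>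

definition best :: "'a distribution \<Rightarrow> 'a distribution \<Rightarrow> bool" where
  "best D E \<longleftrightarrow> 0 < pebbles E \<and> 4 * K * pebbles E \<le> 15 * growth D E \<and>
    (\<forall>F. 0 < pebbles F \<longrightarrow> growth D F * pebbles E \<le> growth D E * pebbles F)"

lemma card_inner_add: "card (inner (D + E)) = card (inner D) + growth D E"
  using card_inner_mono by (simp add: growth_def)

lemma growth_le: "growth D E \<le> card (verts G)"
  using card_mono[OF finite_verts inner_verts, of "D + E"] by (simp add: growth_def)

text \<open>Growth is bounded, so an extension meeting the threshold has at most
  \<open>15 * card (verts G)\<close> pebbles. Thus only finitely many ratios compete.\<close>

lemma best_exists:
  assumes "\<not> stuck_distribution G D"
  shows "\<exists>E. best D E"
proof -
  define good where "good E \<longleftrightarrow> 0 < pebbles E \<and> 4 * K * pebbles E \<le> 15 * growth D E" for E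
  define f where "f E = real (growth D E) / real (pebbles E)" for E
  have good_ex: "\<exists>E. good E"
    using assms pebbling_graph_axioms
    by (auto simp: stuck_distribution_def stuck_distribution_axioms_def card_inner_add good_def not_less)
  have "f ` {E. good E} \<subseteq> (\<lambda>(g, s). real g / real s) ` ({..card (verts G)} \<times> {..15 * card (verts G)})"
  proof
    fix y assume "y \<in> f ` {E. good E}"
    then obtain E where E: "good E" "y = f E" by auto
    have "pebbles E \<le> 4 * K * pebbles E" by (simp add: K_def)
    with E have "pebbles E \<le> 15 * card (verts G)"
      using growth_le[of D E] unfolding good_def by linarith
    with E growth_le[of D E]
    show "y \<in> (\<lambda>(g, s). real g / real s) ` ({..card (verts G)} \<times> {..15 * card (verts G)})"
      by (auto simp: f_def intro!: image_eqI[of _ _ "(growth D E, pebbles E)"])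
  qed
  then have fin: "finite (f ` {E. good E})"
    by (rule finite_subset) auto
  have "Max (f ` {E. good E}) \<in> f ` {E. good E}"
    using good_ex by (intro Max_in fin) auto
  then obtain E where E: "good E" "f E = Max (f ` {E. good E})" by auto
  have E_max: "f F \<le> f E" if "good F" for F
    unfolding E(2) using that by (intro Max_ge fin) auto
  have "growth D F * pebbles E \<le> growth D E * pebbles F" if F: "0 < pebbles F" for F
  proof (cases "good F")
    case True
    with E_max[OF True] E(1) F have "real (growth D F * pebbles E) \<le> real (growth D E * pebbles F)"
      by (simp add: f_def good_def field_simps)
    then show ?thesis by linarith
  next
    case False
    with F have "15 * growth D F \<le> 4 * K * pebbles F" by (simp add: good_def)
    then have "15 * growth D F * pebbles E \<le> 4 * K * pebbles F * pebbles E"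
      by (rule mult_right_mono) simp
    also have "\<dots> = 4 * K * pebbles E * pebbles F" by simp
    also have "\<dots> \<le> 15 * growth D E * pebbles F"
      using E(1) by (intro mult_right_mono) (simp_all add: good_def)
    finally show ?thesis by simp
  qed
  with E(1) show ?thesis by (auto simp: best_def good_def)
qed

text \<open>Every best extension creates a new inner vertex, so the process ends.\<close>

lemma chain_exists:
  "\<exists>N Ds Es. Ds 0 = D \<and> (\<forall>j<N. best (Ds j) (Es j) \<and> Ds (Suc j) = Ds j + Es j)
    \<and> stuck_distribution G (Ds N)"
proof (induction "card (verts G) - card (inner D)" arbitrary: D rule: less_induct)
  case less
  show ?case
  proof (cases "stuck_distribution G D")
    case True
    then show ?thesis by (intro exI[of _ 0] exI[of _ "\<lambda>_. D"]) auto
  next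
    case False
    then obtain E where E: "best D E" using best_exists by blast
    have "0 < growth D E"
      using E by (auto simp: best_def K_def intro: ccontr)
    then have "card (verts G) - card (inner (D + E)) < card (verts G) - card (inner D)"
      using card_mono[OF finite_verts inner_verts, of "D + E"] by (simp add: card_inner_add)
    from less[OF this] obtain N Ds Es where *: "Ds 0 = D + E"
      "\<forall>j<N. best (Ds j) (Es j) \<and> Ds (Suc j) = Ds j + Es j" "stuck_distribution G (Ds N)"
      by blast
    let ?Ds = "case_nat D Ds" and ?Es = "case_nat E Es"
    have "\<forall>j<Suc N. best (?Ds j) (?Es j) \<and> ?Ds (Suc j) = ?Ds j + ?Es j"
      using * E by (auto split: nat.split)
    moreover have "?Ds 0 = D" by simp
    moreover have "stuck_distribution G (?Ds (Suc N))" using * by simp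
    ultimately show ?thesis by blast
  qed
qed

text \<open>Otherwise \<open>E + F\<close> would have a better ratio than \<open>E\<close>.\<close>

lemma best_decreasing:
  assumes "best D E" "best (D + E) F"
  shows "growth (D + E) F * pebbles E \<le> growth D E * pebbles F"
proof -
  have "0 < pebbles (E + F)" using assms by (simp add: best_def)
  then have "growth D (E + F) * pebbles E \<le> growth D E * pebbles (E + F)"
    using assms(1) unfolding best_def by blast
  moreover have "growth D (E + F) = growth D E + growth (D + E) F"
    using card_inner_add[of D "E + F"] card_inner_add[of D E] card_inner_add[of "D + E" F]
    by (simp add: add.assoc)
  ultimately show ?thesis by (simp add: algebra_simps)
qed

text \<open>The competitor is 4 pebbles on \<open>r\<close> and 2 on \<open>v\<close>:
  \<open>r\<close> can send 2 to \<open>v\<close>, so either end can collect 4 and both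
  neighbourhoods become inner.\<close>

lemma best_edge:
  assumes best: "best D E" and r: "r \<in> verts G" "r \<notin> reached D" and v: "v \<in> nb r" "v \<notin> reached D"
  shows "card (nb r \<union> nb v) * pebbles E \<le> 6 * growth D E"
proof -
  let ?F = "pile r 4 + pile v 2"
  have vV: "v \<in> verts G" using r v nb_verts by auto
  have r4: "gets (D + ?F) r 4"
    by (intro gets_addI1 gets_addI2 gets_self) simp
  have "gets ?F v 4"
    using gets_add[OF gets_nb_4[OF gets_self[of 4 "pile r 4" r] v(1)] gets_self[of 2 "pile v 2" v]] by simp
  then have v4: "gets (D + ?F) v 4" by (rule gets_addI2)
  have "nb r \<union> nb v \<subseteq> inner (D + ?F)"
    using gets_nb_4[OF r4] gets_nb_4[OF v4] inner_if_gets_2 nb_verts r(1) vV by blast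
  moreover have "(nb r \<union> nb v) \<inter> inner D = {}"
    using nb_inner_disjoint r v by blast
  ultimately have "card (nb r \<union> nb v) + card (inner D) \<le> card (inner (D + ?F))"
    using inner_add[of D ?F] finite_inner finite_nb r(1) vV
    by (subst card_Un_disjoint[symmetric]) (auto intro!: card_mono)
  then have "card (nb r \<union> nb v) \<le> growth D ?F" by (simp add: growth_def)
  then have "card (nb r \<union> nb v) * pebbles E \<le> growth D ?F * pebbles E"
    by (rule mult_le_mono1)
  also have "\<dots> \<le> growth D E * pebbles ?F"
    using best r(1) unfolding best_def by (elim conjE allE[of _ ?F]) simp
  finally show ?thesis using r(1) vV by simp
qed

lemma pebbles_sum: "finite Q \<Longrightarrow> pebbles (sum f Q) = (\<Sum>C\<in>Q. pebbles (f C))"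
  by (induction rule: finite_induct) (simp_all only: sum.empty sum.insert pebbles_zero pebbles_add not_False_eq_True)

end

text \<open>Summation by parts: the left side combines prefix sums with the nonnegative coefficients
  \<open>\<rho> j - \<rho> (Suc j)\<close> and, at the end, \<open>\<rho> (N - 1)\<close>. Their
  total is \<open>\<rho> 0\<close>, at most 1, and \<open>M\<close> is nonnegative by the empty
  prefix.\<close>

lemma weighted_sum_le_if_prefix_sums_le:
  fixes x \<rho> :: "nat \<Rightarrow> real"
  assumes prefix: "\<And>J. J \<le> N \<Longrightarrow> (\<Sum>j<J. x j) \<le> M"
    and decreasing: "\<And>j. Suc j < N \<Longrightarrow> \<rho> (Suc j) \<le> \<rho> j"
    and bounds: "\<And>j. j < N \<Longrightarrow> 0 \<le> \<rho> j \<and> \<rho> j \<le> 1"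
  shows "(\<Sum>j<N. \<rho> j * x j) \<le> M"
proof -
  have M: "0 \<le> M" using prefix[of 0] by simp
  have *: "(\<Sum>j<Suc n. \<rho> j * x j) \<le> M * (\<rho> 0 - \<rho> n) + \<rho> n * (\<Sum>j<Suc n. x j)" if "n < N" for n
    using that
  proof (induction n)
    case (Suc n)
    have "(\<rho> n - \<rho> (Suc n)) * (\<Sum>j<Suc n. x j) \<le> (\<rho> n - \<rho> (Suc n)) * M"
      using Suc.prems prefix[of "Suc n"] decreasing[of n] by (intro mult_left_mono) auto
    with Suc show ?case by (simp add: algebra_simps)
  qed simp
  show ?thesis
  proof (cases N)
    case (Suc n)
    have "(\<Sum>j<N. \<rho> j * x j) \<le> M * (\<rho> 0 - \<rho> n) + \<rho> n * (\<Sum>j<Suc n. x j)"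
      using * Suc by simp
    also have "\<dots> \<le> M * (\<rho> 0 - \<rho> n) + \<rho> n * M"
      using bounds[of n] prefix[of N] Suc by (intro add_left_mono mult_left_mono) auto
    also have "\<dots> \<le> M * 1"
      using bounds[of 0] M Suc mult_left_mono[of "\<rho> 0" 1 M] by (simp add: algebra_simps)
    finally show ?thesis by simp
  qed (use M in simp)
qed

section \<open>Balancing doubled steps against components\<close>

context pebbling_graph
begin

lemma chain_reached_mono:
  assumes "\<And>j. j < N \<Longrightarrow> Ds (Suc j) = Ds j + Es j" "i \<le> j" "j \<le> N"
  shows "reached (Ds i) \<subseteq> reached (Ds j)"
  using assms(2,3)
proof (induction j rule: dec_induct)
  case (step j)
  then have "reached (Ds i) \<subseteq> reached (Ds j)" "Ds (Suc j) = Ds j + Es j"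
    using assms(1) by simp_all
  then show ?case using reached_add1 by (metis order_trans)
qed simp

theorem optimal_pebbling_number_bound:
  assumes conn: "\<And>u v. u \<in> verts G \<Longrightarrow> v \<in> verts G \<Longrightarrow> u \<rightarrow>\<^sup>*\<^bsub>G\<^esub> v"
    and far: "\<exists>u\<in>verts G. \<exists>v\<in>verts G. nb u \<inter> nb v = {}"
  shows "real (optimal_pebbling_number G) \<le> 15 / 4 * (real (card (verts G)) / real K)"
proof -
  obtain N Ds Es where Ds0: "Ds 0 = 0"
    and chain: "\<And>j. j < N \<Longrightarrow> best (Ds j) (Es j)" "\<And>j. j < N \<Longrightarrow> Ds (Suc j) = Ds j + Es j"
    and stuck: "stuck_distribution G (Ds N)"
    using chain_exists[of 0] by blast
  interpret stuck_distribution G "Ds N" by (rule stuck)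
  define p where "p j = pebbles (Es j)" for j
  define t where "t j = growth (Ds j) (Es j)" for j
  have mono: "reached (Ds i) \<subseteq> reached (Ds j)" if "i \<le> j" "j \<le> N" for i j
    using chain_reached_mono[of N Ds Es] chain(2) that by blast
  have pebbles_Ds: "pebbles (Ds J) = (\<Sum>j<J. p j)" if "J \<le> N" for J
    using that by (induction J) (simp_all add: Ds0 chain p_def)
  have "card (inner (Ds J)) \<ge> (\<Sum>j<J. t j)" if "J \<le> N" for J
    using that by (induction J) (auto simp: chain t_def card_inner_add)
  then have sum_t: "(\<Sum>j<N. t j) + (\<Sum>C\<in>comps. card (\<Union>(nb ` C))) \<le> card (verts G)"
    using card_comps_le by (meson add_le_mono1 le_refl le_trans)
  have p_pos: "0 < p j" and t_ge: "4 * K * p j \<le> 15 * t j" if "j < N" for j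
    using chain(1)[OF that] by (auto simp: best_def p_def t_def)

  \<comment> \<open>Take the first stage reaching a neighbour of \<open>C\<close>. It is not stage
    0, since the empty distribution reaches nothing.\<close>
  have "\<exists>j x r. j < N \<and> x \<in> C \<and> r \<in> nb x \<and> r \<in> reached (Ds (Suc j)) \<and> r \<notin> reached (Ds j)"
    if C: "C \<in> comps" for C
  proof -
    define Q where "Q i \<longleftrightarrow> (\<exists>x\<in>C. \<exists>r\<in>nb x. r \<in> reached (Ds i))" for i
    have QN: "Q N"
      using comps_boundary[OF conn far C] by (auto simp: Q_def R_def)
    define i where "i = (LEAST i. Q i)"
    have Qi: "Q i" and i_least: "\<And>j. j < i \<Longrightarrow> \<not> Q j" and iN: "i \<le> N"
      using QN by (auto simp: i_def intro: LeastI Least_le dest: not_less_Least)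
    have "i \<noteq> 0" using Qi by (auto simp: Q_def Ds0 reached_zero intro!: Nat.gr0I)
    then obtain j where "i = Suc j" by (cases i) auto
    with Qi i_least[of j] iN show ?thesis
      unfolding Q_def by (intro exI[of _ j]) auto
  qed
  then obtain st x r where st: "\<And>C. C \<in> comps \<Longrightarrow> st C < N"
    and x: "\<And>C. C \<in> comps \<Longrightarrow> x C \<in> C"
    and r: "\<And>C. C \<in> comps \<Longrightarrow> r C \<in> nb (x C)"
      "\<And>C. C \<in> comps \<Longrightarrow> r C \<in> reached (Ds (Suc (st C)))"
      "\<And>C. C \<in> comps \<Longrightarrow> r C \<notin> reached (Ds (st C))"
    by metis

  \<comment> \<open>If \<open>st C < J\<close>, both \<open>Ds N\<close> and \<open>Ds J\<close>
    bring a pebble to \<open>r C\<close>. Together they send one to \<open>x C\<close>, so 3 more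
    suffice there.\<close>
  have solution: "optimal_pebbling_number G \<le>
      (\<Sum>j<N. p j) + (\<Sum>j<J. p j) + (\<Sum>C\<in>comps. if st C < J then 3 else 4)" if J: "J \<le> N" for J
  proof -
    define f where "f C = pile (x C) (if st C < J then 3 else 4)" for C
    let ?B = "Ds N + Ds J"
    have "solvable G (?B + sum f comps)"
    proof (rule solvable_if)
      show "reached (Ds N) \<subseteq> reached (?B + sum f comps)"
        using reached_add1[of "Ds N" "Ds J"] reached_add1[of ?B] by blast
    next
      fix C assume C: "C \<in> comps"
      have "gets (?B + f C) (x C) 4"
      proof (cases "st C < J")
        case True
        have "r C \<in> reached (Ds J)" "r C \<in> reached (Ds N)"
          using r(2)[OF C] mono[of "Suc (st C)" J] mono[of "Suc (st C)" N] st[OF C] J True by auto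
        then have "gets ?B (r C) 2"
          using gets_2_if_reached by (auto simp: reached_def)
        then have "gets ?B (x C) 1" using gets_nb_2 r(1)[OF C] nb_sym by blast
        from gets_add[OF this gets_pile[of "x C" 3]] True show ?thesis by (simp add: f_def)
      next
        case False
        then show ?thesis unfolding f_def by (intro gets_addI2 gets_self) simp
      qed
      moreover have "?B + sum f comps = ?B + f C + sum f (comps - {C})"
        using C finite_comps by (simp add: sum.remove add.assoc)
      ultimately show "\<exists>y\<in>C. gets (?B + sum f comps) y 4"
        using x[OF C] gets_addI1 by metis
    qed
    then have "optimal_pebbling_number G \<le> pebbles (?B + sum f comps)"
      by (rule optimal_pebbling_number_le)
    moreover have "pebbles (sum f comps) = (\<Sum>C\<in>comps. if st C < J then 3 else 4)"
      unfolding pebbles_sum[OF finite_comps]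
    proof (intro sum.cong refl)
      fix C assume "C \<in> comps"
      then have "x C \<in> verts G" using x comps_U U_verts by blast
      then show "pebbles (f C) = (if st C < J then 3 else 4)" by (simp add: f_def)
    qed
    ultimately show ?thesis using J by (simp add: pebbles_Ds)
  qed

  define k where "k = real K"
  have k: "0 < k" by (simp add: k_def K_def)
  \<comment> \<open>Chosen so that \<open>(1 + \<rho> j) * p j\<close>, the cost of step
    \<open>j\<close> doubled with weight \<open>\<rho> j\<close>, fits the share
    \<open>15 / 4 * (t j / k)\<close> of the bound.\<close>
  define \<rho> where "\<rho> j = min 1 (15 / 4 * (t j / (k * p j)) - 1)" for j
  define \<pi> where "\<pi> = real (optimal_pebbling_number G)"
  define P where "P = (\<Sum>j<N. real (p j))"
  \<comment> \<open>The net saving from doubling step \<open>j\<close>: one pebble per component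
    first touched there, minus the cost. Prefix sums are at most \<open>M\<close>, as no solution
    beats \<open>\<pi>\<close>.\<close>
  define y where "y j = (\<Sum>C\<in>comps. of_bool (st C = j)) - real (p j)" for j
  define M where "M = P + 4 * real (card comps) - \<pi>"

  have "(\<Sum>j<N. \<rho> j * y j) \<le> M"
  proof (rule weighted_sum_le_if_prefix_sums_le)
    fix J assume J: "J \<le> N"
    have "(\<Sum>j<J. \<Sum>C\<in>comps. of_bool (st C = j)) = (\<Sum>C\<in>comps. \<Sum>j<J. of_bool (st C = j) :: real)"
      by (rule sum.swap)
    also have "\<dots> = (\<Sum>C\<in>comps. of_bool (st C < J))"
      by (intro sum.cong refl) (simp add: of_bool_def)
    finally have "(\<Sum>j<J. y j) = (\<Sum>C\<in>comps. of_bool (st C < J)) - (\<Sum>j<J. real (p j))"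
      by (simp add: y_def sum_subtractf)
    moreover have "\<pi> \<le> P + (\<Sum>j<J. real (p j)) + (\<Sum>C\<in>comps. if st C < J then 3 else 4)"
      using of_nat_mono[OF solution[OF J], where 'a = real] by (simp add: \<pi>_def P_def if_distrib cong: if_cong)
    moreover have "(\<Sum>C\<in>comps. if st C < J then 3 else 4 :: real)
        = 4 * real (card comps) - (\<Sum>C\<in>comps. of_bool (st C < J))"
    proof -
      have "(\<Sum>C\<in>comps. if st C < J then 3 else 4 :: real) = (\<Sum>C\<in>comps. 4 - of_bool (st C < J))"
        by (intro sum.cong) auto
      then show ?thesis by (simp add: sum_subtractf)
    qed
    ultimately show "(\<Sum>j<J. y j) \<le> M" by (simp add: M_def)
  next
    fix j assume j: "Suc j < N"
    have "t (Suc j) * p j \<le> t j * p (Suc j)"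
      using best_decreasing[of "Ds j" "Es j" "Es (Suc j)"] chain[of j] chain[of "Suc j"] j
      by (simp add: t_def p_def)
    then have "real (t (Suc j)) * real (p j) \<le> real (t j) * real (p (Suc j))"
      by (metis of_nat_le_iff of_nat_mult)
    then have "t (Suc j) / (k * p (Suc j)) \<le> t j / (k * p j)"
      using p_pos[of j] p_pos[of "Suc j"] j k by (simp add: field_simps)
    then show "\<rho> (Suc j) \<le> \<rho> j" unfolding \<rho>_def by (intro min.mono) auto
  next
    fix j assume j: "j < N"
    have "4 * k * real (p j) \<le> 15 * real (t j)"
      using of_nat_mono[OF t_ge[OF j], where 'a = real] by (simp add: k_def)
    then show "0 \<le> \<rho> j \<and> \<rho> j \<le> 1"
      using p_pos[OF j] k by (simp add: \<rho>_def field_simps)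
  qed
  moreover have "(\<Sum>j<N. \<rho> j * y j) = (\<Sum>C\<in>comps. \<rho> (st C)) - (\<Sum>j<N. \<rho> j * p j)"
  proof -
    have "(\<Sum>j<N. \<rho> j * (\<Sum>C\<in>comps. of_bool (st C = j)))
        = (\<Sum>C\<in>comps. \<Sum>j<N. \<rho> j * of_bool (st C = j))"
      unfolding sum_distrib_left by (rule sum.swap)
    also have "\<dots> = (\<Sum>C\<in>comps. \<rho> (st C))"
      using st by (intro sum.cong refl) (simp add: of_bool_def if_distrib cong: if_cong)
    finally show ?thesis by (simp add: y_def right_diff_distrib sum_subtractf)
  qed
  ultimately have "\<pi> \<le> (\<Sum>j<N. (1 + \<rho> j) * p j) + (\<Sum>C\<in>comps. 4 - \<rho> (st C))"
    by (simp add: M_def P_def distrib_right sum.distrib sum_subtractf)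
  \<comment> \<open>Each step is charged to its new inner vertices, each component to its closed
    neighbourhood.\<close>
  also have "\<dots> \<le> (\<Sum>j<N. 15 / 4 * (t j / k)) + (\<Sum>C\<in>comps. 15 / 4 * (card (\<Union>(nb ` C)) / k))"
  proof (intro add_mono sum_mono)
    fix j assume "j \<in> {..<N}"
    then have p: "0 < real (p j)" using p_pos by simp
    have "(1 + \<rho> j) * p j \<le> 15 / 4 * (t j / (k * p j)) * p j"
      using p by (intro mult_right_mono) (auto simp: \<rho>_def)
    also have "\<dots> = 15 / 4 * (t j / k)" using p k by simp
    finally show "(1 + \<rho> j) * p j \<le> 15 / 4 * (t j / k)" .
  next
    fix C assume C: "C \<in> comps"
    let ?j = "st C"
    define g where "g = real (card (nb (r C) \<inter> nb (x C)))"
    have j: "?j < N" using st[OF C] .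
    have xU: "x C \<in> U" using x[OF C] comps_U[OF C] by auto
    have xV: "x C \<in> verts G" and rV: "r C \<in> verts G"
      using xU U_verts nb_verts r(1)[OF C] by blast+
    have rN: "r C \<in> reached (Ds N)" using r(2)[OF C] mono[of "Suc ?j" N] j by auto
    \<comment> \<open>Both ends of the edge are unreached before step \<open>st C\<close>, as
      \<open>best_edge\<close> requires.\<close>
    have "x C \<notin> reached (Ds ?j)"
      using xU mono[of ?j N] j by (auto simp: U_def)
    then have "card (nb (r C) \<union> nb (x C)) * p ?j \<le> 6 * t ?j"
      unfolding p_def t_def
      using best_edge[OF chain(1)[OF j] rV r(3)[OF C]] r(1)[OF C] nb_sym by blast
    moreover have "card (nb (r C)) + card (nb (x C))
        = card (nb (r C) \<union> nb (x C)) + card (nb (r C) \<inter> nb (x C))"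
      using xV rV finite_nb by (intro card_Un_Int) auto
    then have "2 * k - g \<le> card (nb (r C) \<union> nb (x C))"
      using card_nb_ge[OF xV] card_nb_ge[OF rV] by (simp add: g_def k_def)
    ultimately have "(2 * k - g) * p ?j \<le> 6 * t ?j"
      by (smt (verit) mult_right_mono of_nat_0_le_iff of_nat_mono of_nat_mult of_nat_numeral)
    then have "(2 * k - g) * p ?j / (6 * (k * p ?j)) \<le> 6 * t ?j / (6 * (k * p ?j))"
      using k by (intro divide_right_mono) simp_all
    then have "(2 - g / k) / 6 \<le> t ?j / (k * p ?j)"
      using p_pos[OF j] k by (simp add: diff_divide_distrib)
    moreover have "K + card (nb (r C) \<inter> nb (x C)) \<le> card (\<Union>(nb ` C))"
      using card_nbs_ge[OF C x[OF C]] r(1)[OF C] rN by (simp add: R_def)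
    then have "k + g \<le> card (\<Union>(nb ` C))" by (simp add: k_def g_def)
    then have "(k + g) / k \<le> card (\<Union>(nb ` C)) / k"
      using k by (intro divide_right_mono) auto
    then have "1 + g / k \<le> card (\<Union>(nb ` C)) / k" using k by (simp add: add_divide_distrib)
    moreover have "0 \<le> g / k" using k by (simp add: g_def)
    \<comment> \<open>If \<open>\<rho> ?j = 1\<close>, the left side is 3. Otherwise it is at most
      \<open>15 / 4 + 5 / 8 * (g / k)\<close>, and the right side is at least
      \<open>15 / 4 * (1 + g / k)\<close>.\<close>
    ultimately show "4 - \<rho> ?j \<le> 15 / 4 * (card (\<Union>(nb ` C)) / k)"
      by (simp add: \<rho>_def min_def)
  qed
  also have "\<dots> = 15 / 4 * (((\<Sum>j<N. t j) + (\<Sum>C\<in>comps. card (\<Union>(nb ` C)))) / k)"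
    by (simp add: sum_distrib_left sum_divide_distrib add_divide_distrib distrib_left)
  also have "\<dots> \<le> 15 / 4 * (card (verts G) / k)"
    using sum_t k by (intro mult_left_mono divide_right_mono) (simp_all flip: of_nat_sum of_nat_add)
  finally show ?thesis by (simp add: \<pi>_def k_def)
qed

end

section \<open>From the diameter to disjoint closed neighbourhoods\<close>

theorem theorem4:
  fixes G :: "('a, 'b) pre_digraph"
  assumes "Digraph.graph G"
    and "Digraph_Component.connected G"
    and "diameter G > 2"
  shows "real (optimal_pebbling_number G)
    \<le> 15 * real (card (verts G)) / (4 * (real (min_degree G) + 1))"
proof -
  interpret pebbling_graph G
    using assms(1) by (simp add: pebbling_graph_def)
  have "u \<rightarrow>\<^sup>*\<^bsub>G\<^esub> v" if "u \<in> verts G" "v \<in> verts G" for u v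
    using assms(2) that sym_arcs
    by (auto simp: connected_def strongly_connected_def reachable_mk_symmetric_eq)
  \<comment> \<open>If all closed neighbourhoods met, a common element would give a walk of at most
    two arcs between any two vertices.\<close>
  moreover have "\<exists>u\<in>verts G. \<exists>v\<in>verts G. nb u \<inter> nb v = {}"
  proof (rule ccontr)
    assume near: "\<not> ?thesis"
    have "graph_dist G u v \<le> 2" if uv: "u \<in> verts G" "v \<in> verts G" for u v
    proof -
      have walk: "\<exists>q. awalk a q b \<and> awalk_cost (\<lambda>_. 1) q \<le> 1" if "a \<in> verts G" "b \<in> nb a" for a b
      proof (cases "a = b")
        case True
        with that show ?thesis by (intro exI[of _ "[]"]) (simp add: awalk_Nil_iff)
      next
        case False
        with that obtain e where "e \<in> arcs G" "tail G e = a" "head G e = b"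
          by (auto simp: nb_def arcs_ends_conv)
        then show ?thesis by (intro exI[of _ "[e]"]) (auto intro: arc_implies_awalk)
      qed
      obtain w where w: "w \<in> nb u" "w \<in> nb v" using near uv by auto
      then have "w \<in> verts G" "v \<in> nb w" using uv nb_verts nb_sym by auto
      with walk[OF uv(1) w(1)] walk[of w v] obtain q q' where
        "awalk u q w" "awalk w q' v" "awalk_cost (\<lambda>_. 1) q \<le> 1" "awalk_cost (\<lambda>_. 1) q' \<le> 1"
        by blast
      then have "awalk u (q @ q') v" "awalk_cost (\<lambda>_. 1) (q @ q') \<le> 2" by auto
      then have "graph_dist G u v \<le> ereal (awalk_cost (\<lambda>_. 1) (q @ q'))"
        unfolding graph_dist_def by (intro min_cost_le_walk_cost)
      also have "\<dots> \<le> 2"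
        using \<open>awalk_cost (\<lambda>_. 1) (q @ q') \<le> 2\<close> by (simp add: numeral_eq_ereal del: awalk_cost_append)
      finally show ?thesis .
    qed
    then have "diameter G \<le> 2"
      unfolding diameter_def by (intro SUP_least) auto
    with assms(3) show False by simp
  qed
  ultimately have "real (optimal_pebbling_number G) \<le> 15 / 4 * (real (card (verts G)) / real K)"
    by (rule optimal_pebbling_number_bound)
  then show ?thesis by (simp add: K_def add.commute)
qed

end
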